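(* Let $A$ be the Hurt-Sada array, let $\varphi=(1+\sqrt5)/2$, and for $n\ge 1$ let $d'(n)=A[n-1,n]$. There is a finite automaton with $6$ states that, given the Zeckendorf representation of $n\geq 1$ as input, decides whether $d'(n)\ge n$ (it accepts if and only if $d'(n)\ge n$). Moreover, for all $n\ge 1$: if $d'(n)\ge n$ then $d'(n)=\lfloor (2\varphi-2)n+\tfrac12\rfloor$; if $d'(n)<n$ then $d'(n)=\lfloor (4-2\varphi)n\rfloor$.
   Context: The Hurt-Sada array $A=(A[n,k])_{n,k\ge 0}$ is defined as follows. Row $0$ is $A[0,k]=k$ for all $k\ge 0$. For $n\ge 1$, row $n$ is obtained from row $n-1$ by finding the unique occurrence of $n$ in row $n-1$, say $A[n-1,i]=n$, and shifting this entry $n$ positions to the right (it jumps over the next $n$ entries): $A[n,j]=A[n-1,j]$ for $0\le j<i$; $A[n,j]=A[n-1,j+1]$ for $i\le j<i+n$; $A[n,i+n]=n$; and $A[n,j]=A[n-1,j]$ for $j>i+n$. Each row is a permutation of $\{0,1,2,\ldots\}$. Zeckendorf representation: with $F_0=0$, $F_1=1$, $F_i=F_{i-1}+F_{i-2}$ for $i\ge 2$, every non-negative integer is uniquely a sum of distinct, pairwise non-adjacent Fibonacci numbers $F_i$, $i\ge 2$. The binary string $a_1a_2\cdots a_t$ (most significant digit first, no two consecutive $1$s, no leading zeros) represents $\sum_{1\le i\le t}a_iF_{t+2-i}$. A finite automaton has a finite set of states, labeled (deterministic) transitions between states, an initial state and a set of accepting states; it reads a finite input word starting in the initial state and accepts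 if and only if it is in an accepting state after reading the whole word (if a needed transition is absent, the input is rejected). *)

theory Defs
  imports Complex_Main "HOL-Number_Theory.Fib"
begin

definition jump :: "nat \<Rightarrow> nat \<Rightarrow> (nat \<Rightarrow> nat) \<Rightarrow> nat \<Rightarrow> nat" where
  "jump i m r j =
     (if j < i then r j
      else if j < i + m then r (j + 1)
      else if j = i + m then r i
      else r j)"

text \<open>
  Each row is a permutation of the natural numbers, so the description operator below picks the
  unique position of \<open>Suc n\<close> in row \<open>n\<close>.
\<close>

primrec hurt_sada :: "nat \<Rightarrow> nat \<Rightarrow> nat" where
  "hurt_sada 0 = (\<lambda>k. k)"
| "hurt_sada (Suc n) = jump (THE i. hurt_sada n i = Suc n) (Suc n) (hurt_sada n)"

text \<open>Meant for \<open>n \<ge> 1\<close> only.\<close>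

definition hs_diag :: "nat \<Rightarrow> nat" where
  "hs_diag n = hurt_sada (n - 1) n"

text \<open>
  Bit strings are lists of Booleans, most significant digit first. List positions count from
  \<open>0\<close>, so the last digit of a string has weight \<open>fib 2 = 1\<close>.
\<close>

definition fib_value :: "bool list \<Rightarrow> nat" where
  "fib_value w = (\<Sum>i<length w. of_bool (w ! i) * fib (length w + 1 - i))"

definition zeckendorf_rep :: "nat \<Rightarrow> bool list \<Rightarrow> bool" where
  "zeckendorf_rep n w \<longleftrightarrow>
     (w \<noteq> [] \<longrightarrow> hd w) \<and>
     (\<forall>i. Suc i < length w \<longrightarrow> \<not> (w ! i \<and> w ! Suc i)) \<and>
     fib_value w = n"

text \<open>Finite automata with a partial transition function; a missing transition rejects.\<close>

record ('q, 'a) dfa =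
  states :: "'q set"
  start :: 'q
  accepting :: "'q set"
  step :: "'q \<Rightarrow> 'a \<Rightarrow> 'q option"

definition wf_dfa :: "('q, 'a) dfa \<Rightarrow> bool" where
  "wf_dfa M \<longleftrightarrow>
     finite (states M) \<and> start M \<in> states M \<and> accepting M \<subseteq> states M \<and>
     (\<forall>q\<in>states M. \<forall>a q'. step M q a = Some q' \<longrightarrow> q' \<in> states M)"

primrec run :: "('q, 'a) dfa \<Rightarrow> 'q \<Rightarrow> 'a list \<Rightarrow> 'q option" where
  "run M q [] = Some q"
| "run M q (a # w) = (case step M q a of None \<Rightarrow> None | Some q' \<Rightarrow> run M q' w)"

definition accepts :: "('q, 'a) dfa \<Rightarrow> 'a list \<Rightarrow> bool" where
  "accepts M w \<longleftrightarrow> (\<exists>q\<in>accepting M. run M (start M) w = Some q)"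

definition golden :: real where
  "golden = (1 + sqrt 5) / 2"

end

theory Submission
  imports Defs
begin

text \<open>
  Write \<open>a x = \<lfloor>\<phi> x\<rfloor>\<close> and \<open>b x = a x + x = \<lfloor>\<phi>\<^sup>2 x\<rfloor>\<close>. In row \<open>n\<close> only the positions
  \<open>k\<close> with \<open>a (n + 2) \<le> k + n + 2\<close> and \<open>k < a (n + 1)\<close> are disturbed, and there the entry is
  \<open>x - 1\<close> where \<open>k + n + 2\<close> is \<open>a x\<close> or \<open>b x\<close>, according to whether \<open>x - 1\<close> is still to jump or
  has already jumped; each jump merely shifts this window. Hence \<open>d'(n) + 1\<close> is the \<open>x\<close> with
  \<open>2 n + 1 = a x\<close> or \<open>2 n + 1 = b x\<close>, and \<open>d'(n) \<ge> n\<close> holds exactly in the first case.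

  Which case occurs depends on \<open>\<delta> = v - \<phi> n\<close>, \<open>v\<close> an integer with \<open>\<phi> - 2 < \<delta> < \<phi> - 1\<close>. If \<open>n\<close>
  is read from its digits and \<open>v\<close> is the value of these digits followed by a \<open>0\<close>, then appending a
  digit \<open>c\<close> turns \<open>\<delta>\<close> into \<open>\<psi> \<delta> + \<psi>\<^sup>2 c\<close> with \<open>\<psi> = 1 - \<phi>\<close>. The three values of \<open>\<delta>\<close> at which
  the case changes have only two further preimages under these maps inside the interval; the five
  points cut it into six intervals, which are the states of the automaton.
\<close>

section \<open>The golden ratio and its Beatty sequence\<close>

lemma golden_square: "golden * golden = golden + 1"
proof -
  have "sqrt 5 * sqrt 5 = (5::real)" by simp
  then show ?thesis unfolding golden_def by (simp add: field_simps)
qed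

lemma golden_gt: "1618 / 1000 < golden"
proof -
  have "2236 / 1000 < sqrt (5::real)" by (rule real_less_rsqrt) (simp add: power2_eq_square)
  then show ?thesis unfolding golden_def by simp
qed

lemma golden_lt: "golden < 16181 / 10000"
proof -
  have "sqrt (5::real) < 22362 / 10000" by (rule real_less_lsqrt) (simp_all add: power2_eq_square)
  then show ?thesis unfolding golden_def by simp
qed

lemma golden_mult_left: "golden * (golden * x) = golden * x + x"
proof -
  have "golden * (golden * x) = (golden * golden) * x" by simp
  then show ?thesis by (simp only: golden_square) (simp add: algebra_simps)
qed

text \<open>Descent along the Euclidean algorithm: a solution \<open>(k, n)\<close> gives the smaller
  solution \<open>(n, k - n)\<close>.\<close>

lemma golden_mult_nat_neq:
  fixes n k :: nat
  assumes "n > 0"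
  shows "golden * real n \<noteq> real k"
  using assms
proof (induction n arbitrary: k rule: less_induct)
  case (less n)
  show ?case
  proof
    assume eq: "golden * real n = real k"
    have "1618 / 1000 * real n < golden * real n" "golden * real n < 16181 / 10000 * real n"
      using golden_gt golden_lt less.prems by simp_all
    with eq have b: "real n < real k" "real k < 2 * real n" using less.prems by linarith+
    then have k: "n < k" "k - n < n" "k - n > 0" by linarith+
    have "golden * real k = real k + real n"
      using golden_mult_left[of "real n"] eq by simp
    then have "golden * real (k - n) = real n"
      using k eq by (simp add: of_nat_diff algebra_simps)
    with less.IH[OF k(2) k(3)] show False by blast
  qed
qed

definition beatty :: "nat \<Rightarrow> nat" where
  "beatty n = nat \<lfloor>golden * real n\<rfloor>"

lemma beatty_le: "real (beatty n) \<le> golden * real n"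
  using golden_gt unfolding beatty_def by simp

lemma beatty_gt: "golden * real n < real (beatty n) + 1"
proof -
  have "0 \<le> \<lfloor>golden * real n\<rfloor>" using golden_gt by simp
  then show ?thesis
    using floor_correct[of "golden * real n"] unfolding beatty_def by simp
qed

lemma beatty_less: "n > 0 \<Longrightarrow> real (beatty n) < golden * real n"
  using beatty_le[of n] golden_mult_nat_neq[of n "beatty n"] by linarith

lemma beatty_eqI:
  assumes "real k \<le> golden * real n" "golden * real n < real k + 1"
  shows "beatty n = k"
proof -
  have "\<lfloor>golden * real n\<rfloor> = int k" using assms by (intro floor_unique) auto
  then show ?thesis unfolding beatty_def by simp
qed

lemma beatty_Suc_ge: "beatty n + 1 \<le> beatty (Suc n)"
  and beatty_Suc_le: "beatty (Suc n) \<le> beatty n + 2"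
proof -
  have e: "golden * real (Suc n) = golden * real n + golden" by (simp add: algebra_simps)
  have "real (beatty n) < real (beatty (Suc n))"
    using e beatty_le[of n] beatty_gt[of "Suc n"] golden_gt by linarith
  then show "beatty n + 1 \<le> beatty (Suc n)" by linarith
  have "real (beatty (Suc n)) < real (beatty n) + 3"
    using e beatty_le[of "Suc n"] beatty_gt[of n] golden_lt by linarith
  then show "beatty (Suc n) \<le> beatty n + 2" by linarith
qed

lemma strict_mono_beatty: "strict_mono beatty"
  unfolding strict_mono_Suc_iff using beatty_Suc_ge by (metis Suc_eq_plus1 Suc_le_eq)

lemmas beatty_less_iff = strict_mono_less[OF strict_mono_beatty]
lemmas beatty_le_iff = strict_mono_less_eq[OF strict_mono_beatty]
lemmas beatty_eq_iff = strict_mono_eq[OF strict_mono_beatty]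

lemma beatty_simps [simp]: "beatty (Suc 0) = 1" "beatty 2 = 3"
  by (rule beatty_eqI; use golden_gt golden_lt in simp)+

lemma beatty_ge: "n \<le> beatty n"
  by (rule strict_mono_imp_increasing[OF strict_mono_beatty])

lemma beatty_ge_Suc: "n \<ge> 2 \<Longrightarrow> n + 1 \<le> beatty n"
proof (induction n rule: dec_induct)
  case (step n)
  then show ?case using beatty_Suc_ge[of n] by simp
qed simp

section \<open>Beatty values at and just after a Beatty value\<close>

definition beatty_frac :: "nat \<Rightarrow> real" where
  "beatty_frac m = golden * real m - real (beatty m)"

text \<open>Substituting \<phi> m - f for \<open>beatty m\<close>, f the fractional part of \<phi>
  m, and using \<open>\<phi>\<^sup>2 = \<phi> + 1\<close>, the integers separate from one small
  error term; its size decides the Beatty values at \<open>beatty m\<close> and just after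
  it.\<close>

lemma golden_mult_beatty:
  "golden * real (beatty m) = real (beatty m) + real m - (golden - 1) * beatty_frac m"
  unfolding beatty_frac_def by (simp add: algebra_simps golden_mult_left golden_square)

lemma scaled_beatty_frac:
  assumes "m > 0"
  shows "0 < (golden - 1) * beatty_frac m" "(golden - 1) * beatty_frac m < golden - 1"
proof -
  have "0 < beatty_frac m" "beatty_frac m < 1"
    using beatty_less[OF assms] beatty_gt[of m] unfolding beatty_frac_def by simp_all
  then show "0 < (golden - 1) * beatty_frac m" "(golden - 1) * beatty_frac m < golden - 1"
    using golden_gt by simp_all
qed

lemma scaled_beatty_frac_gt:
  assumes "beatty (Suc m) = beatty m + 2" "m > 0"
  shows "2 * golden - 3 < (golden - 1) * beatty_frac m"
proof -
  have "golden * real (Suc m) = golden * real m + golden" by (simp add: algebra_simps)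
  then have "2 - golden < beatty_frac m"
    using beatty_less[of "Suc m"] assms(1) unfolding beatty_frac_def by simp
  then have "(golden - 1) * (2 - golden) < (golden - 1) * beatty_frac m"
    using golden_gt by simp
  moreover have "(golden - 1) * (2 - golden) = 2 * golden - 3"
    by (simp add: algebra_simps golden_square)
  ultimately show ?thesis by simp
qed

lemma beatty_beatty: "m > 0 \<Longrightarrow> beatty (beatty m) + 1 = beatty m + m"
proof -
  assume m: "m > 0"
  then have "beatty m > 0" using beatty_ge[of m] by linarith
  with m have "beatty (beatty m) = beatty m + m - 1"
    using golden_mult_beatty[of m] scaled_beatty_frac[OF m] golden_lt
    by (intro beatty_eqI) (simp_all add: of_nat_diff)
  with m show ?thesis by simp
qed

lemma beatty_beatty_Suc:
  assumes "m > 0" shows "beatty (Suc (beatty m)) = beatty m + m + 1"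
  using golden_mult_beatty[of m] scaled_beatty_frac[OF assms] golden_gt golden_lt
  by (intro beatty_eqI) (simp_all add: algebra_simps)

lemma beatty_beatty_add_2:
  assumes "beatty (Suc m) = beatty m + 2" "m > 0"
  shows "beatty (beatty m + 2) = beatty m + m + 2"
  using golden_mult_beatty[of m] scaled_beatty_frac[OF assms(2)] scaled_beatty_frac_gt[OF assms]
    golden_gt golden_lt
  by (intro beatty_eqI) (simp_all add: algebra_simps)

text \<open>\<phi> times the argument is m + \<phi> (1 - f), f the fractional part of \<phi> m; the
  gap of 2 forces 1 - f < \<phi> - 1 = 1/\<phi>.\<close>

lemma beatty_beatty_diff:
  assumes "beatty (Suc m) = beatty m + 2" "m > 0"
  shows "beatty (beatty m - m + 1) = m"
proof -
  have "golden * real (beatty m - m + 1)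
      = golden * real (beatty m) - golden * real m + golden"
    using beatty_ge[of m] by (simp add: of_nat_diff algebra_simps)
  also have "\<dots> = real m + golden - golden * beatty_frac m"
    using golden_mult_beatty[of m] unfolding beatty_frac_def by (simp add: algebra_simps)
  finally have e: "golden * real (beatty m - m + 1) = real m + golden * (1 - beatty_frac m)"
    by (simp add: algebra_simps)
  have "golden * real (Suc m) = golden * real m + golden" by (simp add: algebra_simps)
  then have f: "1 - beatty_frac m < golden - 1" "0 < 1 - beatty_frac m"
    using beatty_less[of "Suc m"] beatty_gt[of m] assms(1) unfolding beatty_frac_def by simp_all
  have "golden * (1 - beatty_frac m) < golden * (golden - 1)" using f(1) golden_gt by simp
  also have "\<dots> = 1" by (simp add: algebra_simps golden_square)
  finally have u: "golden * (1 - beatty_frac m) < 1" .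
  have "0 < golden * (1 - beatty_frac m)" using f(2) golden_gt by simp
  with u e show ?thesis by (intro beatty_eqI) linarith+
qed

text \<open>\<open>beatty y + y\<close> falls strictly between the consecutive Beatty values at
  \<open>beatty y\<close> and \<open>Suc (beatty y)\<close>.\<close>

lemma beatty_disjoint:
  assumes "y > 0"
  shows "beatty x \<noteq> beatty y + y"
proof
  assume "beatty x = beatty y + y"
  then have "beatty (beatty y) < beatty x" "beatty x < beatty (Suc (beatty y))"
    using beatty_beatty[OF assms] beatty_beatty_Suc[OF assms] by linarith+
  then show False unfolding beatty_less_iff by linarith
qed

section \<open>The rows of the array\<close>

lemma jump_inj:
  assumes "inj r" shows "inj (jump i m r)"
proof (rule injI)
  fix j k assume "jump i m r j = jump i m r k"
  with assms show "j = k"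
    unfolding jump_def by (auto dest!: injD split: if_splits)
qed

lemma inj_hurt_sada: "inj (hurt_sada n)"
  by (induction n) (simp_all add: jump_inj)

text \<open>The last two clauses bound k on one side only; the range of x supplies the other end of
  the window.\<close>

definition row_invariant :: "nat \<Rightarrow> (nat \<Rightarrow> nat) \<Rightarrow> bool" where
  "row_invariant n r \<longleftrightarrow>
     (\<forall>k. k + n + 2 < beatty (n + 2) \<longrightarrow> r k = k) \<and>
     (\<forall>k. beatty (n + 1) \<le> k \<longrightarrow> r k = k) \<and>
     (\<forall>k x. n + 2 \<le> x \<longrightarrow> k < beatty (n + 1) \<longrightarrow> k + n + 2 = beatty x \<longrightarrow> r k = x - 1) \<and>
     (\<forall>k x. 1 \<le> x \<longrightarrow> x \<le> n + 1 \<longrightarrow> beatty (n + 2) \<le> k + n + 2 \<longrightarrow>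
        k + n + 2 = beatty x + x \<longrightarrow> r k = x - 1)"

lemma row_invariant_front:
  assumes "row_invariant n r"
  shows "r (beatty (n + 2) - (n + 2)) = n + 1"
proof (cases "n = 0")
  case True
  \<comment> \<open>For n = 0 the window is empty, and the front position 1 belongs to the fixed
    tail.\<close>
  then show ?thesis using assms unfolding row_invariant_def by (simp add: numeral_2_eq_2[symmetric])
next
  case False
  have "beatty (n + 2) \<le> beatty (n + 1) + 2" using beatty_Suc_le[of "n + 1"] by simp
  then have "beatty (n + 2) - (n + 2) < beatty (n + 1)" using False beatty_ge[of "n+1"] by linarith
  moreover have "beatty (n + 2) - (n + 2) + n + 2 = beatty (n + 2)"
    using beatty_ge[of "n + 2"] by simp
  ultimately have "r (beatty (n + 2) - (n + 2)) = n + 2 - 1"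
    using assms unfolding row_invariant_def by blast
  then show ?thesis by simp
qed

text \<open>A shifted entry moves one place left while n grows by one, so k + n + 2 and hence its x
  are preserved. The jumping entry n + 1 lands at \<open>beatty (n + 2) - 1\<close>, where the new
  sum is \<open>beatty (n + 2) + (n + 2)\<close>: its x = n + 2 passes from the third clause to the
  fourth.\<close>

lemma row_invariant_jump:
  assumes inv: "row_invariant n r"
  shows "row_invariant (Suc n) (jump (beatty (n + 2) - (n + 2)) (Suc n) r)" (is "row_invariant _ ?r")
proof -
  have low: "r k = k" if "k + n + 2 < beatty (n + 2)" for k
    using inv that unfolding row_invariant_def by blast
  have high: "r k = k" if "beatty (n + 1) \<le> k" for k
    using inv that unfolding row_invariant_def by blast
  have lower: "r k = x - 1" if "n + 2 \<le> x" "k < beatty (n + 1)" "k + n + 2 = beatty x" for k x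
    using inv that unfolding row_invariant_def by blast
  have upper: "r k = x - 1"
    if "1 \<le> x" "x \<le> n + 1" "beatty (n + 2) \<le> k + n + 2" "k + n + 2 = beatty x + x" for k x
    using inv that unfolding row_invariant_def by blast
  have ge: "n + 2 \<le> beatty (n + 2)" by (rule beatty_ge)
  have s1: "beatty (n + 1) + 1 \<le> beatty (n + 2)" "beatty (n + 2) \<le> beatty (n + 1) + 2"
    using beatty_Suc_ge[of "n + 1"] beatty_Suc_le[of "n + 1"] by simp_all
  have s2: "beatty (n + 2) + 1 \<le> beatty (n + 3)" "beatty (n + 3) \<le> beatty (n + 2) + 2"
    using beatty_Suc_ge[of "n + 2"] beatty_Suc_le[of "n + 2"] by (simp_all add: eval_nat_numeral)
  have j1: "?r j = r j" if "j + n + 2 < beatty (n + 2)" for j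
    using that ge unfolding jump_def by auto
  have j2: "?r j = r (j + 1)" if "beatty (n + 2) \<le> j + n + 2" "j + 1 < beatty (n + 2)" for j
    using that ge unfolding jump_def by auto
  have j3: "?r j = n + 1" if "j + 1 = beatty (n + 2)" for j
    using that ge row_invariant_front[OF inv] unfolding jump_def by auto
  have j4: "?r j = r j" if "beatty (n + 2) \<le> j" for j
    using that ge unfolding jump_def by auto
  have c1: "?r j = j" if a: "j + n + 3 < beatty (n + 3)" for j
  proof (cases "j + n + 2 < beatty (n + 2)")
    case True
    then show ?thesis using j1 low by simp
  next
    case False
    \<comment> \<open>A gap of 2 lets position j leave the window on the left. The entry arriving
      there falls under the fourth clause with x = j + 1, because
      \<open>beatty (j + 1) = n + 2\<close>; so it equals j.\<close>
    then have j: "j + n + 2 = beatty (n + 2)" and b: "beatty (Suc (n + 2)) = beatty (n + 2) + 2"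
      using a s2 by (simp_all add: eval_nat_numeral)
    have "beatty (beatty (n + 2) - (n + 2) + 1) = n + 2" by (rule beatty_beatty_diff[OF b]) simp
    moreover have "beatty (n + 2) - (n + 2) + 1 = j + 1" using j by simp
    ultimately have e: "beatty (j + 1) = n + 2" by simp
    have "j + 1 \<le> n + 1"
    proof (cases "j + 1 \<ge> 2")
      case True
      then show ?thesis using beatty_ge_Suc[of "j + 1"] e by simp
    qed simp
    then have "r (j + 1) = (j + 1) - 1" by (intro upper) (use e j in linarith)+
    moreover have "?r j = r (j + 1)" by (rule j2) (use j in linarith)+
    ultimately show ?thesis by simp
  qed
  have c2: "?r j = j" if "beatty (n + 2) \<le> j" for j
    using that j4 high s1 by simp
  have c3: "?r j = x - 1" if x: "n + 3 \<le> x" and j: "j < beatty (n + 2)" "j + n + 3 = beatty x" for j x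
  proof -
    have "beatty (n + 3) \<le> beatty x" using x by (simp add: beatty_le_iff)
    then have l: "beatty (n + 2) \<le> j + n + 2" using j s2 by linarith
    \<comment> \<open>That position is taken by the entry that has just jumped.\<close>
    have "j + 1 \<noteq> beatty (n + 2)" using beatty_disjoint[of "n + 2" x] j by linarith
    then have l2: "j + 1 < beatty (n + 2)" using j by linarith
    show ?thesis
    proof (cases "j + 1 < beatty (n + 1)")
      case True
      then have "r (j + 1) = x - 1" using lower[of x "j + 1"] x j by simp
      then show ?thesis using j2[OF l l2] by simp
    next
      case False
      \<comment> \<open>Position j + 1 lay in the fixed tail and held j + 1, so x has to be j + 2.
        As j + 1 is \<open>beatty (n + 1)\<close> or one more, \<open>beatty (j + 2)\<close> is
        known.\<close>
      have "beatty x = beatty (j + 2)"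
      proof (cases "j + 1 = beatty (n + 1)")
        case True
        have "beatty (Suc (beatty (n + 1))) = beatty (n + 1) + (n + 1) + 1"
          by (rule beatty_beatty_Suc) simp
        then show ?thesis using True[symmetric] j by simp
      next
        case F: False
        then have e: "j = beatty (n + 1)" "beatty (Suc (n + 1)) = beatty (n + 1) + 2"
          using False l2 s1 by simp_all
        have "beatty (beatty (n + 1) + 2) = beatty (n + 1) + (n + 1) + 2"
          by (rule beatty_beatty_add_2[OF e(2)]) simp
        then show ?thesis using e(1) j by simp
      qed
      then have "x = j + 2" by (simp only: beatty_eq_iff)
      then show ?thesis using j2[OF l l2] high[of "j + 1"] False by simp
    qed
  qed
  have c4: "?r j = x - 1"
    if x: "1 \<le> x" "x \<le> n + 2" and j: "beatty (n + 3) \<le> j + n + 3" "j + n + 3 = beatty x + x" for j x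
  proof (cases "x = n + 2")
    case True
    then show ?thesis using j3[of j] j by simp
  next
    case False
    then have x': "x \<le> n + 1" using x by simp
    then have "beatty x < beatty (n + 2)" by (simp add: beatty_less_iff)
    then have "j + 1 < beatty (n + 2)" using j x' by linarith
    moreover have "beatty (n + 2) \<le> j + n + 2" using j s2 by linarith
    ultimately show ?thesis using j2[of j] upper[of x "j + 1"] x x' j by simp
  qed
  show ?thesis
    unfolding row_invariant_def
    using c1 c2 c3 c4 by (simp add: eval_nat_numeral)
qed

lemma row_invariant_hurt_sada: "row_invariant n (hurt_sada n)"
proof (induction n)
  case 0
  have "\<not> k + 2 = beatty x" if "2 \<le> x" "k < 1" for k x
    using that beatty_le_iff[of 2 x] by simp
  then show ?case unfolding row_invariant_def by (auto simp: numeral_2_eq_2[symmetric])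
next
  case (Suc n)
  have "(THE i. hurt_sada n i = Suc n) = beatty (n + 2) - (n + 2)"
  proof (rule the_equality)
    show "hurt_sada n (beatty (n + 2) - (n + 2)) = Suc n"
      using row_invariant_front[OF Suc] by simp
    then show "i = beatty (n + 2) - (n + 2)" if "hurt_sada n i = Suc n" for i
      using that injD[OF inj_hurt_sada[of n]] by metis
  qed
  then show ?case using row_invariant_jump[OF Suc] by simp
qed

section \<open>Column n of row n - 1, where k + (n - 1) + 2 = 2 n + 1\<close>

lemma hs_diag_lower:
  assumes "n \<ge> 1" "beatty x = 2 * n + 1" "n < x"
  shows "hs_diag n = x - 1"
proof (cases "n = 1")
  case True
  \<comment> \<open>Column 1 of row 0 lies to the right of the window, out of reach of the third
    clause.\<close>
  then have "beatty x = beatty 2" using assms by simp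
  then have "x = 2" by (simp only: beatty_eq_iff)
  then show ?thesis using True by (simp add: hs_diag_def)
next
  case False
  then have "n + 1 \<le> beatty n" using assms(1) by (intro beatty_ge_Suc) simp
  then show ?thesis
    using row_invariant_hurt_sada[of "n - 1"] assms
    unfolding row_invariant_def hs_diag_def by simp
qed

lemma hs_diag_upper:
  assumes "n \<ge> 1" "beatty x + x = 2 * n + 1" "x \<ge> 1" "x \<le> n"
  shows "hs_diag n = x - 1"
proof -
  \<comment> \<open>\<phi> < 2 keeps column n from lying to the left of the window.\<close>
  have "real (beatty (n + 1)) \<le> golden * real (n + 1)" by (rule beatty_le)
  also have "\<dots> < 2 * real (n + 1)" using golden_lt by (intro mult_strict_right_mono) auto
  finally have "real (beatty (n + 1)) < real (2 * (n + 1))" by simp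
  then have "beatty (n + 1) < 2 * (n + 1)" by (simp only: of_nat_less_iff)
  then have "beatty (n + 1) \<le> 2 * n + 1" by simp
  then show ?thesis
    using row_invariant_hurt_sada[of "n - 1"] assms
    unfolding row_invariant_def hs_diag_def by simp
qed

section \<open>The two cases for the diagonal\<close>

definition big_case :: "nat \<Rightarrow> bool" where
  "big_case n \<longleftrightarrow> n \<le> hs_diag n \<and> int (hs_diag n) = \<lfloor>(2 * golden - 2) * real n + 1 / 2\<rfloor>"

definition small_case :: "nat \<Rightarrow> bool" where
  "small_case n \<longleftrightarrow> hs_diag n < n \<and> int (hs_diag n) = \<lfloor>(4 - 2 * golden) * real n\<rfloor>"

text \<open>Since \<phi> (\<phi> - 1) = 1, multiplying by \<phi> gives 2 n + 1 < \<phi> x < 2 n + 2,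
  that is, \<open>beatty x = 2 * n + 1\<close>. The same bounds put x strictly between t + 1/2 and t
  + 3/2 for t = (2 \<phi> - 2) n, whence the floor of t + 1/2 is x - 1.\<close>

lemma big_caseI:
  assumes n: "n \<ge> 1"
    and x: "(golden - 1) * (2 * real n + 1) < of_int x" "of_int x < (golden - 1) * (2 * real n + 2)"
  shows "big_case n"
proof -
  define t where "t = (2 * golden - 2) * real n"
  have l: "(golden - 1) * (2 * real n + 1) = t + golden - 1"
    "(golden - 1) * (2 * real n + 2) = t + 2 * golden - 2"
    unfolding t_def by (simp_all add: algebra_simps)
  have "1236 / 1000 * real n \<le> t"
    using golden_gt unfolding t_def by (intro mult_right_mono) auto
  then have "real n < of_int x" using x(1) l n golden_gt by linarith
  then have "int n < x" by linarith
  then obtain y :: nat where y: "x = int y" "n < y"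
    by (intro that[of "nat x"]) simp_all
  have g: "golden * ((golden - 1) * z) = z" for z
    using golden_mult_left[of z] by (simp add: algebra_simps golden_mult_left)
  have "golden * ((golden - 1) * (2 * real n + 1)) < golden * real y"
    "golden * real y < golden * ((golden - 1) * (2 * real n + 2))"
    using x y golden_gt by simp_all
  then have "beatty y = 2 * n + 1" unfolding g by (intro beatty_eqI) simp_all
  then have d: "hs_diag n = y - 1" using n y by (intro hs_diag_lower) simp_all
  moreover have "\<lfloor>t + 1 / 2\<rfloor> = int (y - 1)"
    using x l y golden_gt golden_lt by (intro floor_unique) (simp_all add: of_nat_diff)
  ultimately show ?thesis using y unfolding big_case_def t_def by simp
qed

text \<open>Here the multiplier is \<phi> + 1, the inverse of 2 - \<phi>, which leads to
  \<open>beatty x + x = 2 * n + 1\<close>.\<close>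

lemma small_caseI:
  assumes n: "n \<ge> 1"
    and x: "(2 - golden) * (2 * real n + 1) < of_int x" "of_int x < (2 - golden) * (2 * real n + 2)"
  shows "small_case n"
proof -
  define t where "t = (4 - 2 * golden) * real n"
  have l: "(2 - golden) * (2 * real n + 1) = t + 2 - golden"
    "(2 - golden) * (2 * real n + 2) = t + 4 - 2 * golden"
    unfolding t_def by (simp_all add: algebra_simps)
  have "0 < t" "t \<le> 764 / 1000 * real n"
    using golden_gt golden_lt n unfolding t_def by (simp_all add: mult_right_mono)
  moreover have xt: "t + 2 - golden < of_int x" "of_int x < t + 4 - 2 * golden"
    using x unfolding l by simp_all
  ultimately have "0 < (of_int x :: real)" "of_int x < real n + 1"
    using golden_gt golden_lt assms(1) by linarith+
  then have "0 < x" "x < int n + 1" by linarith+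
  then obtain y :: nat where y: "x = int y" "1 \<le> y" "y \<le> n"
    by (intro that[of "nat x"]) simp_all
  have g: "(golden + 1) * ((2 - golden) * z) = z" for z
    using golden_mult_left[of z] by (simp add: algebra_simps golden_mult_left)
  have "(golden + 1) * ((2 - golden) * (2 * real n + 1)) < (golden + 1) * real y"
    "(golden + 1) * real y < (golden + 1) * ((2 - golden) * (2 * real n + 2))"
    using x y golden_gt by simp_all
  then have "beatty y = 2 * n + 1 - y"
    unfolding g using y by (intro beatty_eqI) (simp_all add: of_nat_diff algebra_simps)
  then have d: "hs_diag n = y - 1" using n y by (intro hs_diag_upper) simp_all
  moreover have "\<lfloor>t\<rfloor> = int (y - 1)"
    using xt y golden_gt golden_lt by (intro floor_unique) (simp_all add: of_nat_diff)
  ultimately show ?thesis using y unfolding small_case_def t_def by simp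
qed

text \<open>With \<phi> n = v - d, the integer x = 2 v - 2 n + s meets the bounds of
  \<open>big_caseI\<close> iff \<phi> - 1 - s < 2 d < 2 \<phi> - 2 - s; s = 0 and s = 1 give the two
  ranges.\<close>

lemma big_case_of_offset:
  assumes "n \<ge> 1" and d: "d = of_int v - golden * real n"
    and r: "(golden - 1) / 2 < d \<and> d < golden - 1 \<or> (golden - 2) / 2 < d \<and> d < (2 * golden - 3) / 2"
  shows "big_case n"
proof -
  have l: "(golden - 1) * (2 * real n + 1) = 2 * (golden * real n) + golden - 2 * real n - 1"
    "(golden - 1) * (2 * real n + 2) = 2 * (golden * real n) + 2 * golden - 2 * real n - 2"
    by (simp_all add: algebra_simps)
  show ?thesis
    using r
  proof (elim disjE)
    assume "(golden - 1) / 2 < d \<and> d < golden - 1"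
    then show ?thesis using golden_gt golden_lt assms(1) unfolding d
      by (intro big_caseI[where x = "2 * v - 2 * int n"]) (simp_all only: l, simp_all)
  next
    assume "(golden - 2) / 2 < d \<and> d < (2 * golden - 3) / 2"
    then show ?thesis using golden_gt golden_lt assms(1) unfolding d
      by (intro big_caseI[where x = "2 * v - 2 * int n + 1"]) (simp_all only: l, simp_all)
  qed
qed

text \<open>Likewise x = 4 n - 2 v + s meets the bounds of \<open>small_caseI\<close> iff 2 \<phi> -
  4 + s < 2 d < \<phi> - 2 + s, with s = 1 and s = 0.\<close>

lemma small_case_of_offset:
  assumes "n \<ge> 1" and d: "d = of_int v - golden * real n"
    and r: "(2 * golden - 3) / 2 < d \<and> d < (golden - 1) / 2 \<or> golden - 2 < d \<and> d < (golden - 2) / 2"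
  shows "small_case n"
proof -
  have l: "(2 - golden) * (2 * real n + 1) = 4 * real n + 2 - 2 * (golden * real n) - golden"
    "(2 - golden) * (2 * real n + 2) = 4 * real n + 4 - 2 * (golden * real n) - 2 * golden"
    by (simp_all add: algebra_simps)
  show ?thesis
    using r
  proof (elim disjE)
    assume "(2 * golden - 3) / 2 < d \<and> d < (golden - 1) / 2"
    then show ?thesis using golden_gt golden_lt assms(1) unfolding d
      by (intro small_caseI[where x = "4 * int n - 2 * v + 1"]) (simp_all only: l, simp_all)
  next
    assume "golden - 2 < d \<and> d < (golden - 2) / 2"
    then show ?thesis using golden_gt golden_lt assms(1) unfolding d
      by (intro small_caseI[where x = "4 * int n - 2 * v"]) (simp_all only: l, simp_all)
  qed
qed

lemma big_or_small_case:
  assumes "n \<ge> 1" shows "big_case n \<or> small_case n"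
proof -
  \<comment> \<open>This is the integer with \<phi> (n + 1) - 2 < v < \<phi> (n + 1) - 1.\<close>
  define v where "v = int (beatty (Suc n)) - 1"
  define d where "d = of_int v - golden * real n"
  have "real (beatty (Suc n)) < golden * real n + golden"
    "golden * real n + golden < real (beatty (Suc n)) + 1"
    using beatty_less[of "Suc n"] beatty_gt[of "Suc n"] by (simp_all add: algebra_simps)
  then have d1: "golden - 2 < d" "d < golden - 1" unfolding d_def v_def by simp_all
  have "beatty (Suc n) \<ge> 1" using beatty_ge[of "Suc n"] by linarith
  then have v: "of_int v = real (nat v)" unfolding v_def by simp
  \<comment> \<open>Doubling an equality at any of these borders would make \<phi> times a positive
    integer an integer.\<close>
  have "d \<noteq> (golden - 2) / 2" "d \<noteq> (golden - 1) / 2" "d \<noteq> (2 * golden - 3) / 2"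
    using golden_mult_nat_neq[of "2 * n + 1" "2 * nat v + 2"]
      golden_mult_nat_neq[of "2 * n + 1" "2 * nat v + 1"]
      golden_mult_nat_neq[of "2 * n + 2" "2 * nat v + 3"]
    unfolding d_def v by (auto simp: algebra_simps)
  then show ?thesis
    using d1 big_case_of_offset[OF assms d_def] small_case_of_offset[OF assms d_def]
    by linarith
qed

section \<open>The automaton\<close>

text \<open>The case changes at cuts 1, 3 and 4. Digit 1 sends cut 5 to cut 3 and cut 2 to cut 5;
  these are the two added preimages. Cuts 0 and 6 are the ends.\<close>

definition cut :: "nat \<Rightarrow> real" where
  "cut q = [golden - 2, (golden - 2) / 2, (3 * golden - 5) / 2, (2 * golden - 3) / 2,
            (golden - 1) / 2, (3 * golden - 4) / 2, golden - 1] ! q"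

definition cut_step :: "nat \<Rightarrow> bool \<Rightarrow> nat" where
  "cut_step q c = (if c then [5, 5, 4, 3, 3, 2] ! q else [3, 2, 2, 1, 0, 0] ! q)"

text \<open>State q stands for the interval between \<open>cut q\<close> and
  \<open>cut (Suc q)\<close>. The empty string has offset 0, which lies in interval 2. States 1, 2
  and states 4, 5 make up the two ranges of the big case, split by cuts 2 and 5.\<close>

definition diag_dfa :: "(nat, bool) dfa" where
  "diag_dfa = \<lparr>states = {..<6}, start = 2, accepting = {1, 2, 4, 5},
               step = (\<lambda>q c. Some (cut_step q c))\<rparr>"

lemma less_6_cases:
  fixes q :: nat
  assumes "q < 6"
  obtains "q = 0" | "q = 1" | "q = 2" | "q = 3" | "q = 4" | "q = 5"
  using assms by linarith

lemma cut_step_less: "q < 6 \<Longrightarrow> cut_step q c < 6"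
  by (erule less_6_cases) (simp_all add: cut_step_def)

lemma wf_diag_dfa: "wf_dfa diag_dfa"
  by (auto simp: wf_dfa_def diag_dfa_def cut_step_less)

lemma cut_step_interval:
  assumes q: "q < 6" and d: "cut q < d" "d < cut (Suc q)"
    and e_def: "e = (1 - golden) * d + of_bool c * (2 - golden)"
  shows "cut (cut_step q c) < e" "e < cut (Suc (cut_step q c))"
proof -
  have "(golden - 1) * cut q < (golden - 1) * d" "(golden - 1) * d < (golden - 1) * cut (Suc q)"
    using d golden_gt by simp_all
  then have e: "of_bool c * (2 - golden) - (golden - 1) * cut (Suc q) < e"
    "e < of_bool c * (2 - golden) - (golden - 1) * cut q"
    unfolding e_def by (simp_all add: algebra_simps)
  \<comment> \<open>Multiplying by 1 - \<phi> < 0 reverses the order, so the right end of the old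
    interval bounds the new offset from below. Only the ends are compared, in twelve cases.\<close>
  have "cut (cut_step q c) \<le> of_bool c * (2 - golden) - (golden - 1) * cut (Suc q) \<and>
      of_bool c * (2 - golden) - (golden - 1) * cut q \<le> cut (Suc (cut_step q c))"
    using q golden_gt golden_lt
    by (elim less_6_cases; cases c)
      (simp_all add: cut_def cut_step_def golden_square golden_mult_left field_simps)
  with e show "cut (cut_step q c) < e" "e < cut (Suc (cut_step q c))" by linarith+
qed

section \<open>Values of digit strings followed by zeros, and runs of the automaton\<close>

definition shifted_value :: "nat \<Rightarrow> bool list \<Rightarrow> nat" where
  "shifted_value k w = (\<Sum>i<length w. of_bool (w ! i) * fib (length w + k - i))"

lemma fib_value_eq_shifted: "fib_value w = shifted_value 1 w"
  by (simp add: fib_value_def shifted_value_def)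

lemma shifted_value_snoc:
  "shifted_value k (w @ [c]) = shifted_value (Suc k) w + of_bool c * fib (Suc k)"
  by (simp add: shifted_value_def nth_append)

lemma shifted_value_rec:
  "shifted_value (Suc (Suc k)) w = shifted_value (Suc k) w + shifted_value k w"
proof -
  have "fib (length w + Suc (Suc k) - i) = fib (length w + Suc k - i) + fib (length w + k - i)"
    if "i < length w" for i
  proof -
    have "length w + Suc (Suc k) - i = Suc (Suc (length w + k - i))"
      "length w + Suc k - i = Suc (length w + k - i)" using that by simp_all
    then show ?thesis by simp
  qed
  then show ?thesis
    unfolding shifted_value_def sum.distrib[symmetric]
    by (intro sum.cong) (simp_all add: algebra_simps)
qed

lemma run_snoc:
  "run M q (w @ [c]) = (case run M q w of None \<Rightarrow> None | Some q' \<Rightarrow> step M q' c)"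
  by (induction w arbitrary: q) (simp_all split: option.split)

lemma run_diag_dfa:
  "\<exists>q<6. run diag_dfa 2 w = Some q \<and>
     cut q < real (shifted_value 2 w) - golden * real (fib_value w) \<and>
     real (shifted_value 2 w) - golden * real (fib_value w) < cut (Suc q)"
proof (induction w rule: rev_induct)
  case Nil
  show ?case using golden_gt golden_lt
    by (intro exI[of _ 2]) (simp add: shifted_value_def fib_value_def cut_def)
next
  case (snoc c w)
  define d where "d = real (shifted_value 2 w) - golden * real (fib_value w)"
  obtain q where q: "q < 6" "run diag_dfa 2 w = Some q" "cut q < d" "d < cut (Suc q)"
    using snoc unfolding d_def by blast
  have "shifted_value 2 (w @ [c]) = shifted_value 2 w + shifted_value 1 w + of_bool c * 2"
    using shifted_value_rec[of 1 w] by (simp add: shifted_value_snoc eval_nat_numeral)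
  moreover have "shifted_value 1 (w @ [c]) = shifted_value 2 w + of_bool c"
    by (simp add: shifted_value_snoc numeral_2_eq_2)
  \<comment> \<open>\<open>\<phi>\<^sup>2 - \<phi> = 1\<close> absorbs the extra
    \<open>shifted_value 1 w\<close>, so the new offset depends on d and c alone.\<close>
  ultimately have "real (shifted_value 2 (w @ [c])) - golden * real (fib_value (w @ [c]))
      = (1 - golden) * d + of_bool c * (2 - golden)"
    unfolding d_def fib_value_eq_shifted
    by (simp add: algebra_simps golden_mult_left)
  moreover have "run diag_dfa 2 (w @ [c]) = Some (cut_step q c)"
    using q by (simp add: run_snoc diag_dfa_def)
  ultimately show ?case
    using cut_step_interval[OF q(1,3,4), of _ c] cut_step_less[OF q(1), of c] by auto
qed

lemma accepts_diag_dfa: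
  assumes "fib_value w \<ge> 1"
  shows "accepts diag_dfa w \<longleftrightarrow> fib_value w \<le> hs_diag (fib_value w)"
proof -
  define d where "d = of_int (int (shifted_value 2 w)) - golden * real (fib_value w)"
  obtain q where q: "q < 6" "run diag_dfa 2 w = Some q" "cut q < d" "d < cut (Suc q)"
    using run_diag_dfa[of w] unfolding d_def by auto
  have a: "accepts diag_dfa w \<longleftrightarrow> q \<in> {1, 2, 4, 5}"
    using q(2) by (simp add: accepts_def diag_dfa_def)
  show ?thesis
  proof (cases "q \<in> {1, 2, 4, 5}")
    case True
    with q(3,4) have "big_case (fib_value w)"
      using golden_gt golden_lt
      by (intro big_case_of_offset[OF assms d_def]) (auto simp: cut_def)
    with True a show ?thesis by (simp add: big_case_def)
  next
    case False
    with q have "small_case (fib_value w)"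
      by (intro small_case_of_offset[OF assms d_def], elim less_6_cases) (auto simp: cut_def)
    with False a show ?thesis by (auto simp: small_case_def)
  qed
qed

theorem theorem9:
  shows "(\<exists>M :: (nat, bool) dfa.
            wf_dfa M \<and> card (states M) = 6 \<and>
            (\<forall>n w. n \<ge> 1 \<longrightarrow> zeckendorf_rep n w \<longrightarrow>
               (accepts M w \<longleftrightarrow> hs_diag n \<ge> n)))
       \<and> (\<forall>n\<ge>1.
            (hs_diag n \<ge> n \<longrightarrow>
               int (hs_diag n) = \<lfloor>(2 * golden - 2) * real n + 1 / 2\<rfloor>) \<and>
            (hs_diag n < n \<longrightarrow>
               int (hs_diag n) = \<lfloor>(4 - 2 * golden) * real n\<rfloor>))"
proof (intro conjI exI[of _ diag_dfa] allI impI)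
  show "wf_dfa diag_dfa" by (rule wf_diag_dfa)
  show "card (states diag_dfa) = 6" by (simp add: diag_dfa_def)
  show "accepts diag_dfa w \<longleftrightarrow> n \<le> hs_diag n" if "1 \<le> n" "zeckendorf_rep n w" for n w
    using that accepts_diag_dfa[of w] by (simp add: zeckendorf_rep_def)
  show "int (hs_diag n) = \<lfloor>(2 * golden - 2) * real n + 1 / 2\<rfloor>" if "1 \<le> n" "n \<le> hs_diag n" for n
    using that big_or_small_case[of n] by (auto simp: big_case_def small_case_def)
  show "int (hs_diag n) = \<lfloor>(4 - 2 * golden) * real n\<rfloor>" if "1 \<le> n" "hs_diag n < n" for n
    using that big_or_small_case[of n] by (auto simp: big_case_def small_case_def)
qed

end
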